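(* Let $n\ge1$ and $d_1<d_2$, and let $X=V(K_1)\cap V(K_2)\subset\mathbf{P}^{n+2}$ be the intersection of the Klein hypersurface $V(K_1)$ of degree $d_1$ and the reverse-order Klein hypersurface $V(K_2)$ of degree $d_2$. If $X$ is smooth, then: (i) $n$ is even (equivalently, $n+3$ is odd); and (ii) for every divisor $k>1$ of $n+3$ with $d_j\not\equiv0\pmod k$ for $j=1,2$, one has $d_1\not\equiv d_2\pmod k$.
   Context: We work over $\mathbf{C}$, with homogeneous coordinates $x_0,\dots,x_{n+2}$ on $\mathbf{P}^{n+2}$. The Klein polynomial $K_1$ of degree $d_1$ and the reverse-order Klein polynomial $K_2$ of degree $d_2$ are $$K_1=x_0^{d_1-1}x_1+x_1^{d_1-1}x_2+\cdots+x_{n+1}^{d_1-1}x_{n+2}+x_{n+2}^{d_1-1}x_0,$$ $$K_2=x_1^{d_2-1}x_0+x_2^{d_2-1}x_1+\cdots+x_{n+2}^{d_2-1}x_{n+1}+x_0^{d_2-1}x_{n+2}.$$ $X$ is defined by $K_1=K_2=0$ and has dimension $n$. Singularity of $X$ at a point is tested by the Jacobian criterion, that is, by linear dependence of the gradients of $K_1$ and $K_2$ at that point.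
   Formalization: The degrees are assumed to satisfy 2 ≤ d_1 < d_2; for d_1 = 1 part (i) is false, since with d_1 = 1, d_2 = 2, n = 3 the intersection X is smooth although n is odd. *)

theory Defs
  imports "HOL-Analysis.Analysis" "HOL-Number_Theory.Cong"
begin

text \<open>
  Complex projective space of dimension \<open>m\<close>. A vector with coordinates
  \<open>x\<^sub>0, \<dots>, x\<^sub>m\<close> is a function on \<open>nat\<close> that vanishes beyond \<open>m\<close>, so that equal
  coordinates mean equal functions; a point is a class of nonzero vectors up to scaling.
\<close>

definition hom_coords :: "nat \<Rightarrow> (nat \<Rightarrow> complex) set" where
  "hom_coords m = {x. (\<forall>i>m. x i = 0) \<and> (\<exists>i\<le>m. x i \<noteq> 0)}"

definition proj_rel :: "nat \<Rightarrow> ((nat \<Rightarrow> complex) \<times> (nat \<Rightarrow> complex)) set" where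
  "proj_rel m = {(x, y). x \<in> hom_coords m \<and> y \<in> hom_coords m \<and>
                         (\<exists>c. c \<noteq> 0 \<and> y = (\<lambda>i. c * x i))}"

definition proj_space :: "nat \<Rightarrow> (nat \<Rightarrow> complex) set set" where
  "proj_space m = hom_coords m // proj_rel m"

text \<open>
  Polynomials in \<open>x\<^sub>0, \<dots>, x\<^sub>m\<close> are represented by the functions they induce. The zero locus
  is meant for homogeneous \<open>F\<close>, whose vanishing does not depend on the representative.
\<close>

definition zero_locus :: "nat \<Rightarrow> ((nat \<Rightarrow> complex) \<Rightarrow> complex) \<Rightarrow> (nat \<Rightarrow> complex) set set" where
  "zero_locus m F = {p \<in> proj_space m. \<forall>x\<in>p. F x = 0}"

definition partial_deriv ::
    "nat \<Rightarrow> ((nat \<Rightarrow> complex) \<Rightarrow> complex) \<Rightarrow> (nat \<Rightarrow> complex) \<Rightarrow> complex" where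
  "partial_deriv i F x = deriv (\<lambda>t. F (x(i := t))) (x i)"

text \<open>
  Dependence of the pair (not the set) of gradients: equal gradients count as dependent.
\<close>

definition gradients_dependent ::
    "nat \<Rightarrow> ((nat \<Rightarrow> complex) \<Rightarrow> complex) \<Rightarrow> ((nat \<Rightarrow> complex) \<Rightarrow> complex)
      \<Rightarrow> (nat \<Rightarrow> complex) \<Rightarrow> bool" where
  "gradients_dependent m F G x \<longleftrightarrow>
     (\<exists>a b. (a, b) \<noteq> (0, 0) \<and>
            (\<forall>i\<le>m. a * partial_deriv i F x + b * partial_deriv i G x = 0))"

text \<open>Jacobian criterion for the intersection of two hypersurfaces.\<close>

definition smooth_intersection ::
    "nat \<Rightarrow> ((nat \<Rightarrow> complex) \<Rightarrow> complex) \<Rightarrow> ((nat \<Rightarrow> complex) \<Rightarrow> complex) \<Rightarrow> bool" where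
  "smooth_intersection m F G \<longleftrightarrow>
     (\<forall>p \<in> zero_locus m F \<inter> zero_locus m G. \<forall>x\<in>p. \<not> gradients_dependent m F G x)"

text \<open>
  The Klein polynomials of degree \<open>d\<close> in \<open>x\<^sub>0, \<dots>, x\<^sub>m\<close>, for \<open>d \<ge> 1\<close>
  (for \<open>d = 0\<close> the exponent \<open>d - 1\<close> is truncated).
\<close>

definition klein :: "nat \<Rightarrow> nat \<Rightarrow> (nat \<Rightarrow> complex) \<Rightarrow> complex" where
  "klein m d x = (\<Sum>i\<le>m. x i ^ (d - 1) * x ((i + 1) mod (m + 1)))"

definition reverse_klein :: "nat \<Rightarrow> nat \<Rightarrow> (nat \<Rightarrow> complex) \<Rightarrow> complex" where
  "reverse_klein m d x = (\<Sum>i\<le>m. x ((i + 1) mod (m + 1)) ^ (d - 1) * x i)"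

end

theory Submission
  imports Defs
begin

text \<open>
  In each excluded case a singular point of \<open>X\<close> can be written down. If \<open>n + 3\<close> is even, take
  \<open>(1 : 0 : 1 : 0 : \<dots>)\<close>: every monomial involves two neighbouring variables, and both gradients
  are constant on the odd positions and zero on the even ones. If \<open>k\<close> divides \<open>n + 3\<close> but neither
  degree, and \<open>d\<^sub>1 \<equiv> d\<^sub>2\<close> modulo \<open>k\<close>, take \<open>x\<^sub>i = \<omega>\<^sup>i\<close> for a primitive \<open>k\<close>-th root of unity \<open>\<omega>\<close>:
  both polynomials become geometric sums that vanish, and the gradients are multiples of
  \<open>\<omega> ^ (i (d\<^sub>1 - 1))\<close> and \<open>\<omega> ^ (i (d\<^sub>2 - 1))\<close>, which agree.
\<close>

text \<open>Common shape of both polynomials: \<open>\<sigma>\<close> is the cyclic successor for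
  \<open>klein\<close> and, after reindexing, the cyclic predecessor for
  \<open>reverse_klein\<close>. Derivatives and homogeneity are then treated once.\<close>

definition perm_form :: "nat \<Rightarrow> nat \<Rightarrow> (nat \<Rightarrow> nat) \<Rightarrow> (nat \<Rightarrow> complex) \<Rightarrow> complex" where
  "perm_form m e \<sigma> x = (\<Sum>i\<le>m. x i ^ e * x (\<sigma> i))"

lemma perm_form_scale: "perm_form m e \<sigma> (\<lambda>i. c * x i) = c ^ Suc e * perm_form m e \<sigma> x"
  by (simp add: perm_form_def sum_distrib_left power_mult_distrib mult_ac)

text \<open>The variable \<open>x i\<close> enters only the monomials with index \<open>i\<close>
  and index \<open>\<tau>\<close>, the unique preimage of \<open>i\<close> under
  \<open>\<sigma>\<close>. If these coincide, the product rule still yields both summands.\<close>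

lemma partial_deriv_perm_form:
  assumes "\<And>j. j \<le> m \<Longrightarrow> \<sigma> j = i \<longleftrightarrow> j = \<tau>" and "i \<le> m" and "\<tau> \<le> m"
  shows "partial_deriv i (perm_form m e \<sigma>) x
           = of_nat e * x i ^ (e - 1) * x (\<sigma> i) + x \<tau> ^ e"
proof -
  define \<delta> :: "nat \<Rightarrow> complex" where "\<delta> j = (if j = i then 1 else 0)" for j
  have coord: "((\<lambda>t. (x(i := t)) j) has_field_derivative \<delta> j) (at (x i))" for j
    by (cases "j = i") (auto simp: \<delta>_def)
  have "((\<lambda>t. perm_form m e \<sigma> (x(i := t))) has_field_derivative
          (\<Sum>j\<le>m. of_nat e * (x j ^ (e - 1) * \<delta> j) * x (\<sigma> j) + \<delta> (\<sigma> j) * x j ^ e)) (at (x i))"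
    unfolding perm_form_def
    by (rule DERIV_sum)
       (use DERIV_mult[OF DERIV_power[OF coord] coord] in \<open>simp add: mult_ac\<close>)
  then have "partial_deriv i (perm_form m e \<sigma>) x
      = (\<Sum>j\<le>m. of_nat e * (x j ^ (e - 1) * \<delta> j) * x (\<sigma> j) + \<delta> (\<sigma> j) * x j ^ e)"
    unfolding partial_deriv_def by (rule DERIV_imp_deriv)
  also have "\<dots> = (\<Sum>j\<le>m. if j = i then of_nat e * x i ^ (e - 1) * x (\<sigma> i) else 0)
                 + (\<Sum>j\<le>m. if j = \<tau> then x \<tau> ^ e else 0)"
    unfolding sum.distrib[symmetric] by (rule sum.cong) (auto simp: \<delta>_def assms(1))
  finally show ?thesis
    using assms(2,3) by simp
qed

text \<open>Adding \<open>m\<close> modulo \<open>m + 1\<close> is the cyclic predecessor, written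
  without subtraction on naturals.\<close>

lemma cyclic_succ_eq_iff:
  fixes i j m :: nat
  assumes "i \<le> m" "j \<le> m"
  shows "(j + 1) mod (m + 1) = i \<longleftrightarrow> j = (i + m) mod (m + 1)"
proof -
  have "(j + 1) mod (m + 1) = (if j = m then 0 else j + 1)"
    using assms by simp
  moreover have "(i + m) mod (m + 1) = (if i = 0 then m else i - 1)"
    using assms by (cases i) (simp_all add: mod_if)
  ultimately show ?thesis
    using assms by (auto split: if_splits)
qed

lemma klein_eq_perm_form: "klein m d = perm_form m (d - 1) (\<lambda>i. (i + 1) mod (m + 1))"
  by (rule ext) (simp add: klein_def perm_form_def)

lemma reverse_klein_eq_perm_form:
  "reverse_klein m d = perm_form m (d - 1) (\<lambda>i. (i + m) mod (m + 1))"
proof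
  fix x :: "nat \<Rightarrow> complex"
  have bounds: "(a + 1) mod (m + 1) \<le> m" "(a + m) mod (m + 1) \<le> m" for a
    by (simp_all add: less_Suc_eq_le[symmetric])
  have inverse1: "((a + 1) mod (m + 1) + m) mod (m + 1) = a" if "a \<le> m" for a
    using cyclic_succ_eq_iff[OF bounds(1) that, of a] by argo
  have inverse2: "((a + m) mod (m + 1) + 1) mod (m + 1) = a" if "a \<le> m" for a
    using cyclic_succ_eq_iff[OF that bounds(2), of a] by argo
  have "perm_form m (d - 1) (\<lambda>i. (i + m) mod (m + 1)) x
      = (\<Sum>j\<le>m. x ((j + 1) mod (m + 1)) ^ (d - 1) * x j)"
    unfolding perm_form_def
    by (rule sum.reindex_bij_witness[where i = "\<lambda>j. (j + 1) mod (m + 1)"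
              and j = "\<lambda>i. (i + m) mod (m + 1)"])
       (simp_all only: inverse1 inverse2 bounds atMost_iff)
  then show "reverse_klein m d x = perm_form m (d - 1) (\<lambda>i. (i + m) mod (m + 1)) x"
    by (simp add: reverse_klein_def)
qed

lemma partial_deriv_klein:
  assumes "i \<le> m"
  shows "partial_deriv i (klein m d) x
    = of_nat (d - 1) * x i ^ (d - 2) * x ((i + 1) mod (m + 1)) + x ((i + m) mod (m + 1)) ^ (d - 1)"
proof -
  have "(i + m) mod (m + 1) \<le> m"
    by (simp add: less_Suc_eq_le[symmetric])
  from partial_deriv_perm_form[OF cyclic_succ_eq_iff[OF assms] assms this, of "d - 1" x] show ?thesis
    by (simp add: klein_eq_perm_form numeral_2_eq_2)
qed

lemma partial_deriv_reverse_klein: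
  assumes "i \<le> m"
  shows "partial_deriv i (reverse_klein m d) x
    = of_nat (d - 1) * x i ^ (d - 2) * x ((i + m) mod (m + 1)) + x ((i + 1) mod (m + 1)) ^ (d - 1)"
proof -
  have le: "(i + 1) mod (m + 1) \<le> m"
    by (simp add: less_Suc_eq_le[symmetric])
  have "(j + m) mod (m + 1) = i \<longleftrightarrow> j = (i + 1) mod (m + 1)" if "j \<le> m" for j
    using cyclic_succ_eq_iff[OF that assms] by auto
  from partial_deriv_perm_form[OF this assms le, of "d - 1" x] show ?thesis
    by (simp add: reverse_klein_eq_perm_form numeral_2_eq_2)
qed

text \<open>Smoothness speaks of whole classes; homogeneity carries vanishing at one representative
  to all its multiples.\<close>

lemma smooth_intersection_perm_formD:
  assumes smooth: "smooth_intersection m (perm_form m e \<sigma>) (perm_form m e' \<sigma>')"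
    and x: "x \<in> hom_coords m"
    and zero: "perm_form m e \<sigma> x = 0" "perm_form m e' \<sigma>' x = 0"
  shows "\<not> gradients_dependent m (perm_form m e \<sigma>) (perm_form m e' \<sigma>') x"
proof -
  define p where "p = proj_rel m `` {x}"
  have "p \<in> proj_space m"
    unfolding p_def proj_space_def using x by (rule quotientI)
  moreover have "perm_form m e \<sigma> y = 0 \<and> perm_form m e' \<sigma>' y = 0" if "y \<in> p" for y
    using that zero by (auto simp: p_def proj_rel_def perm_form_scale simp del: power_Suc)
  moreover have "x \<in> p"
    using x by (auto simp: p_def proj_rel_def intro!: exI[of _ 1])
  ultimately show ?thesis
    using smooth by (auto simp: smooth_intersection_def zero_locus_def)
qed

lemma smooth_klein_intersectionD:
  assumes "smooth_intersection m (klein m d) (reverse_klein m d')"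
    and "x \<in> hom_coords m" and "klein m d x = 0" and "reverse_klein m d' x = 0"
  shows "\<not> gradients_dependent m (klein m d) (reverse_klein m d') x"
  using assms unfolding klein_eq_perm_form reverse_klein_eq_perm_form
  by (rule smooth_intersection_perm_formD)

text \<open>The bound \<open>3 \<le> d'\<close> kills \<open>0 ^ (d' - 2)\<close>, so the reverse
  gradient is exactly 1 at odd positions.\<close>

lemma not_smooth_klein_odd:
  assumes "odd m" and "2 \<le> d" and "3 \<le> d'"
  shows "\<not> smooth_intersection m (klein m d) (reverse_klein m d')"
proof
  assume smooth: "smooth_intersection m (klein m d) (reverse_klein m d')"
  define x :: "nat \<Rightarrow> complex" where "x i = (if i \<le> m \<and> even i then 1 else 0)" for i
  \<comment> \<open>Since \<open>m + 1\<close> is even, the wraparound from \<open>m\<close> to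
    \<open>0\<close> respects parity.\<close>
  have par: "even (j mod (m + 1)) \<longleftrightarrow> even j" for j :: nat
    using assms(1) by (simp add: dvd_mod_iff)
  have x_mod: "x (j mod (m + 1)) = (if even j then 1 else 0)" for j
    using par[of j] by (auto simp: x_def less_Suc_eq_le[symmetric])
  have "x \<in> hom_coords m"
    by (auto simp: hom_coords_def x_def intro!: exI[of _ 0])
  moreover have "klein m d x = 0"
    unfolding klein_def x_mod using assms by (auto simp: x_def intro!: sum.neutral)
  moreover have "reverse_klein m d' x = 0"
    unfolding reverse_klein_def x_mod using assms by (auto simp: x_def intro!: sum.neutral)
  moreover have "gradients_dependent m (klein m d) (reverse_klein m d') x"
  proof -
    \<comment> \<open>For \<open>d = 2\<close> the factor \<open>0 ^ 0\<close> contributes, so the gradients differ by a factor of 2.\<close>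
    define c :: complex where "c = of_nat (d - 1) * 0 ^ (d - 2) + 1"
    have "1 * partial_deriv i (klein m d) x + (- c) * partial_deriv i (reverse_klein m d') x = 0"
      if "i \<le> m" for i
      unfolding partial_deriv_klein[OF that] partial_deriv_reverse_klein[OF that] x_mod
      using assms that by (auto simp: x_def c_def power_0_left)
    then show ?thesis
      unfolding gradients_dependent_def by (intro exI[of _ 1] exI[of _ "- c"]) simp
  qed
  ultimately show False
    using smooth_klein_intersectionD[OF smooth] by blast
qed

lemma power_cong_root_of_unity:
  fixes w :: "'a :: comm_monoid_mult"
  assumes "w ^ k = 1" and "[a = b] (mod k)"
  shows "w ^ a = w ^ b"
proof -
  have "w ^ a = w ^ (a mod k)" for a
  proof -
    have "w ^ a = w ^ (k * (a div k) + a mod k)" by simp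
    then show ?thesis by (simp only: power_add power_mult assms(1) power_one mult_1_left)
  qed
  then show ?thesis
    using assms(2) by (metis cong_def)
qed

lemma sum_powers_root_of_unity:
  fixes z :: "'a :: field"
  assumes "z ^ (m + 1) = 1" and "z \<noteq> 1"
  shows "(\<Sum>i\<le>m. z ^ i) = 0"
  using geometric_sum[OF assms(2), of "Suc m"] assms(1) by (simp add: lessThan_Suc_atMost)

text \<open>At the chosen point the monomials are \<open>w ^ (i * d + 1)\<close> and
  \<open>w ^ (i * d' + d' - 1)\<close>. Their sums vanish because \<open>w ^ d\<close> and
  \<open>w ^ d'\<close> differ from 1 while their powers of exponent \<open>m + 1\<close> equal
  1.\<close>

lemma not_smooth_klein_root_of_unity:
  fixes k :: nat
  assumes "k > 0" and "k dvd m + 1" and "\<not> k dvd d" and "\<not> k dvd d'" and "[d = d'] (mod k)"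
    and d: "2 \<le> d" "2 \<le> d'"
  shows "\<not> smooth_intersection m (klein m d) (reverse_klein m d')"
proof
  assume smooth: "smooth_intersection m (klein m d) (reverse_klein m d')"
  define w where "w = exp (2 * of_real pi * \<i> * of_nat 1 / of_nat k)"
  have pow: "w ^ a = exp (2 * of_real pi * \<i> * of_nat a / of_nat k)" for a
    unfolding w_def exp_of_nat_mult[symmetric] by (simp add: mult_ac)
  have w_eq_1: "w ^ a = 1 \<longleftrightarrow> k dvd a" for a
    unfolding pow using complex_root_unity_eq_1[of k a] assms(1) by simp
  \<comment> \<open>As \<open>k\<close> divides \<open>m + 1\<close>, the powers of \<open>w\<close>
    are compatible with the cyclic indexing.\<close>
  have w_mod: "w ^ (a mod (m + 1)) = w ^ a" for a
    using power_cong_root_of_unity[of w "m + 1"] w_eq_1[of "m + 1"] assms(2)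
    by (metis cong_mod_left cong_refl)
  define x where "x i = (if i \<le> m then w ^ i else 0)" for i
  have x_le: "x i = w ^ i" if "i \<le> m" for i
    using that by (simp add: x_def)
  have x_mod: "x (j mod (m + 1)) = w ^ j" for j
    using w_mod[of j] by (simp add: x_def less_Suc_eq_le[symmetric])
  have sum0: "(\<Sum>i\<le>m. (w ^ a) ^ i) = 0" if "\<not> k dvd a" for a
  proof (rule sum_powers_root_of_unity)
    show "(w ^ a) ^ (m + 1) = 1"
      unfolding power_mult[symmetric] w_eq_1 using assms(2) by (rule dvd_mult)
  qed (use that w_eq_1 in simp)
  \<comment> \<open>This turns the truncated exponents \<open>d - 1\<close> and \<open>d - 2\<close>
    into \<open>e + 1\<close> and \<open>e\<close>.\<close>
  obtain e e' where e: "d = e + 2" "d' = e' + 2"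
    using d by (metis add.commute le_Suc_ex)
  have "x \<in> hom_coords m"
    by (auto simp: hom_coords_def x_def intro!: exI[of _ 0])
  moreover have "klein m d x = w * (\<Sum>i\<le>m. (w ^ d) ^ i)"
    unfolding klein_def sum_distrib_left
  proof (rule sum.cong)
    fix i assume "i \<in> {..m}"
    then show "x i ^ (d - 1) * x ((i + 1) mod (m + 1)) = w * (w ^ d) ^ i"
      unfolding x_mod by (simp add: x_le e power_add power_mult_distrib mult_ac flip: power_mult)
  qed simp
  then have "klein m d x = 0"
    using sum0 assms by simp
  moreover have "reverse_klein m d' x = w ^ (d' - 1) * (\<Sum>i\<le>m. (w ^ d') ^ i)"
    unfolding reverse_klein_def sum_distrib_left
  proof (rule sum.cong)
    fix i assume "i \<in> {..m}"
    then show "x ((i + 1) mod (m + 1)) ^ (d' - 1) * x i = w ^ (d' - 1) * (w ^ d') ^ i"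
      unfolding x_mod
      by (simp add: x_le e power_add power_mult_distrib mult_ac flip: power_mult)
  qed simp
  then have "reverse_klein m d' x = 0"
    using sum0 assms by simp
  moreover have "gradients_dependent m (klein m d) (reverse_klein m d') x"
  proof -
    \<comment> \<open>\<open>A\<close> and \<open>B\<close> are the partial derivatives at index 0;
      the one at index \<open>i\<close> differs from it by the factor
      \<open>w ^ (i * (d - 1))\<close>, respectively \<open>w ^ (i * (d' - 1))\<close>.\<close>
    define A where "A = of_nat (d - 1) * w + w ^ (m * (d - 1))"
    define B where "B = of_nat (d' - 1) * w ^ m + w ^ (d' - 1)"
    have "partial_deriv i (klein m d) x = A * (w ^ (d - 1)) ^ i" if "i \<le> m" for i
      unfolding partial_deriv_klein[OF that] x_mod A_def using that
      by (simp add: x_le e power_add power_mult_distrib algebra_simps flip: power_mult)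
    moreover have "partial_deriv i (reverse_klein m d') x = B * (w ^ (d' - 1)) ^ i" if "i \<le> m" for i
      unfolding partial_deriv_reverse_klein[OF that] x_mod B_def using that
      by (simp add: x_le e power_add power_mult_distrib algebra_simps flip: power_mult)
    moreover have "w ^ (d - 1) = w ^ (d' - 1)"
    proof (rule power_cong_root_of_unity)
      show "[d - 1 = d' - 1] (mod k)"
        using assms(5) cong_add_rcancel_nat[of "d - 1" 1 "d' - 1" k] d by simp
    qed (use w_eq_1 in simp)
    ultimately have grad: "a * A + b * B = 0 \<Longrightarrow> i \<le> m \<Longrightarrow>
        a * partial_deriv i (klein m d) x + b * partial_deriv i (reverse_klein m d') x = 0" for a b i
      by (simp flip: distrib_right mult.assoc)
    show ?thesis
    \<comment> \<open>The relation \<open>(B, - A)\<close> is nontrivial unless both vanish; if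
      \<open>A = 0\<close>, the first gradient is zero and \<open>(1, 0)\<close> serves.\<close>
    proof (cases "A = 0")
      case True
      then show ?thesis
        unfolding gradients_dependent_def using grad[of 1 0]
        by (intro exI[of _ 1] exI[of _ 0]) auto
    next
      case False
      then show ?thesis
        unfolding gradients_dependent_def using grad[of B "- A"]
        by (intro exI[of _ B] exI[of _ "- A"]) auto
    qed
  qed
  ultimately show False
    using smooth_klein_intersectionD[OF smooth] by blast
qed

theorem corollary4p7:
  fixes n d1 d2 :: nat
  assumes "n \<ge> 1" and "2 \<le> d1" and "d1 < d2"
    and "smooth_intersection (n + 2) (klein (n + 2) d1) (reverse_klein (n + 2) d2)"
  shows "even n \<and>
    (\<forall>k::nat. k > 1 \<and> k dvd n + 3 \<and> \<not> [d1 = 0] (mod k) \<and> \<not> [d2 = 0] (mod k)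
       \<longrightarrow> \<not> [d1 = d2] (mod k))"
proof (intro conjI allI impI notI)
  show "even n"
    \<comment> \<open>Here \<open>n + 2\<close> has the parity of \<open>n\<close>, and
      \<open>2 \<le> d1 < d2\<close> gives \<open>3 \<le> d2\<close>.\<close>
    using not_smooth_klein_odd[of "n + 2" d1 d2] assms by auto
next
  fix k :: nat
  assume k: "k > 1 \<and> k dvd n + 3 \<and> \<not> [d1 = 0] (mod k) \<and> \<not> [d2 = 0] (mod k)"
    and "[d1 = d2] (mod k)"
  moreover have "n + 2 + 1 = n + 3" by simp
  ultimately show False
    using not_smooth_klein_root_of_unity[of k "n + 2" d1 d2] assms
    by (metis cong_0_iff less_trans zero_less_one le_trans less_imp_le)
qed

end
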